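(* Let $d\in\mathbb{N}$, $0<\alpha<d$ and $1<p<q<\frac{d}{\alpha}$. Define $$I_{\alpha}x(k)=\sum_{i\in\mathbb{Z}^d\setminus\{k\}}\frac{x(i)}{\|k-i\|_\infty^{d-\alpha}}\quad (x\in\ell^p_q(\mathbb{Z}^d),\ k\in\mathbb{Z}^d).$$ Set $s=\frac{dp}{d-\alpha q}$ and $t=\frac{qs}{p}$. Then $I_\alpha x\in\ell^s_t(\mathbb{Z}^d)$ for every $x\in\ell^p_q(\mathbb{Z}^d)$, and there exists $C>0$ such that $$\|I_{\alpha}x\|_{\ell^s_t(\mathbb{Z}^d)}\leq C\|x\|_{\ell^p_q(\mathbb{Z}^d)}\quad\text{for all } x\in\ell^p_q(\mathbb{Z}^d).$$
   Context: $\mathbb{N}=\{1,2,3,\dots\}$ and $\omega:=\mathbb{N}\cup\{0\}$. $\|(x_1,\dots,x_d)\|_\infty:=\max\{|x_i|:1\le i\le d\}$, and $|S|$ denotes the cardinality of a set $S$. For $m\in\mathbb{Z}^d$ and $N\in\omega$ let $S_{m,N}:=\{k\in\mathbb{Z}^d:\|k-m\|_\infty\leq N\}$, so $|S_{m,N}|=(2N+1)^d$. For $1\leq p\leq q<\infty$ the discrete Morrey space $\ell^p_q(\mathbb{Z}^d)$ is the space of all functions $x\colon\mathbb{Z}^d\to\mathbb{R}$ for which $$\|x\|_{\ell^p_q(\mathbb{Z}^d)}:=\sup_{m\in\mathbb{Z}^d,\,N\in\omega}|S_{m,N}|^{\frac1q-\frac1p}\Bigl(\sum_{k\in S_{m,N}}|x(k)|^p\Bigr)^{1/p}<\infty;$$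 the space $\ell^s_t(\mathbb{Z}^d)$ and its norm are given by the same definition with $(s,t)$ in place of $(p,q)$. The sum defining $I_\alpha x(k)$ is an unordered infinite sum of real numbers. *)

theory Defs
  imports "HOL-Analysis.Analysis"
begin

text \<open>The lattice of integer points in dimension \<open>d\<close> is \<^typ>\<open>int ^ 'd\<close> with \<open>d = CARD('d)\<close>.\<close>

definition inf_norm :: "int ^ 'd \<Rightarrow> int" where
  "inf_norm x = Max {\<bar>x $ i\<bar> | i. True}"

definition cube :: "int ^ 'd \<Rightarrow> nat \<Rightarrow> (int ^ 'd) set" where
  "cube m N = {k. inf_norm (k - m) \<le> int N}"

definition morrey_avg :: "real \<Rightarrow> real \<Rightarrow> (int ^ 'd \<Rightarrow> real) \<Rightarrow> int ^ 'd \<Rightarrow> nat \<Rightarrow> real" where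
  "morrey_avg p q x m N =
     real (card (cube m N)) powr (1 / q - 1 / p) * (\<Sum>k\<in>cube m N. \<bar>x k\<bar> powr p) powr (1 / p)"

text \<open>The following two definitions are meant for \<open>1 \<le> p \<le> q\<close>. The supremum is taken in the
  reals, so \<open>morrey_norm\<close> is meaningful only on \<open>morrey_space\<close>, the functions for which the
  supremum is finite.\<close>

definition morrey_space :: "real \<Rightarrow> real \<Rightarrow> (int ^ 'd \<Rightarrow> real) set" where
  "morrey_space p q = {x. bdd_above {morrey_avg p q x m N | m N. True}}"

definition morrey_norm :: "real \<Rightarrow> real \<Rightarrow> (int ^ 'd \<Rightarrow> real) \<Rightarrow> real" where
  "morrey_norm p q x = Sup {morrey_avg p q x m N | m N. True}"

definition riesz_term :: "real \<Rightarrow> (int ^ 'd \<Rightarrow> real) \<Rightarrow> int ^ 'd \<Rightarrow> int ^ 'd \<Rightarrow> real" where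
  "riesz_term \<alpha> x k i = x i / real_of_int (inf_norm (k - i)) powr (real CARD('d) - \<alpha>)"

text \<open>\<open>infsum\<close> returns 0 for a family that is not summable, so summability of \<open>riesz_term\<close> has to
  be claimed separately wherever \<open>riesz_potential\<close> is asserted to be well defined.\<close>

definition riesz_potential :: "real \<Rightarrow> (int ^ 'd \<Rightarrow> real) \<Rightarrow> int ^ 'd \<Rightarrow> real" where
  "riesz_potential \<alpha> x k = (\<Sum>\<^sub>\<infinity>i\<in>UNIV - {k}. riesz_term \<alpha> x k i)"

lemma inf_norm_le_iff: "inf_norm x \<le> c \<longleftrightarrow> (\<forall>i. \<bar>x $ i\<bar> \<le> c)"
proof -
  have "{\<bar>x $ i\<bar> | i. True} = range (\<lambda>i. \<bar>x $ i\<bar>)" by auto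
  then show ?thesis by (simp add: inf_norm_def)
qed

lemma cube_eq: "cube m N = vec_lambda ` (\<Pi>\<^sub>E i\<in>UNIV. {m $ i - int N .. m $ i + int N})"
proof (intro set_eqI iffI)
  fix k assume "k \<in> cube m N"
  then have "\<bar>k $ i - m $ i\<bar> \<le> int N" for i
    by (simp add: cube_def inf_norm_le_iff)
  then have "m $ i - int N \<le> k $ i \<and> k $ i \<le> m $ i + int N" for i
    by (smt (verit))
  then have "vec_nth k \<in> (\<Pi>\<^sub>E i\<in>UNIV. {m $ i - int N .. m $ i + int N})"
    by (simp add: PiE_iff)
  then show "k \<in> vec_lambda ` (\<Pi>\<^sub>E i\<in>UNIV. {m $ i - int N .. m $ i + int N})"
    by (metis image_eqI vec_nth_inverse)
next
  fix k assume "k \<in> vec_lambda ` (\<Pi>\<^sub>E i\<in>UNIV. {m $ i - int N .. m $ i + int N})"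
  then show "k \<in> cube m N"
    by (auto simp: cube_def inf_norm_le_iff PiE_iff abs_le_iff algebra_simps)
qed

lemma finite_cube: "finite (cube m N)"
  by (simp add: cube_eq finite_PiE)

lemma card_cube: "card (cube (m :: int ^ 'd) N) = (2 * N + 1) ^ CARD('d)"
proof -
  have "inj_on (vec_lambda :: ('d \<Rightarrow> int) \<Rightarrow> _) A" for A
    by (auto intro!: inj_onI simp: vec_lambda_inject)
  then have "card (cube m N) = card (\<Pi>\<^sub>E i\<in>(UNIV :: 'd set). {m $ i - int N .. m $ i + int N})"
    unfolding cube_eq by (rule card_image)
  also have "\<dots> = (2 * N + 1) ^ CARD('d)"
    by (simp add: card_PiE nat_add_distrib nat_mult_distrib)
  finally show ?thesis .
qed

end

theory Submission
  imports Defs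
begin

text \<open>Normalise \<open>y = \<bar>x\<bar> / A\<close> with \<open>A\<close> above the norm of \<open>x\<close>. The Hardy--Littlewood maximal function is avoided
  by a duality-like argument. Write \<open>F = I\<^sub>\<alpha> y\<close>, \<open>\<beta> = d/q - \<alpha>\<close>, and pick \<open>R(k)\<close> such that \<open>F(k)\<close> is a fixed multiple of
  \<open>R(k)\<close> to the power \<open>-\<beta>\<close>. Neither the points at distance at least \<open>R(k)\<close> from \<open>k\<close> nor those where
  \<open>y\<close> is below a suitable multiple of \<open>R(k)\<close> to the power \<open>-d/q\<close> contribute more than a quarter of \<open>F(k)\<close>. Hence
  \<open>F(k)\<close> is at most twice the sum over the remaining points \<open>i\<close>, and for those \<open>R(k)\<close> exceeds both
  \<open>\<parallel>k - i\<parallel>\<close> and a radius \<open>\<sigma>(i)\<close> that depends only on \<open>y(i)\<close>. Multiplying by the \<open>(s-1)\<close>-st power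
  of \<open>F(k)\<close> and summing over \<open>k\<close> first leaves a convergent kernel sum, which turns \<open>y(i)\<close> into the
  \<open>p\<close>-th power of \<open>y(i)\<close>. If \<open>R(k)\<close> exceeds the size of the cube, the bound on \<open>F(k)\<close> is already
  good enough pointwise.\<close>

section \<open>Weighted sums over dyadic shells\<close>

text \<open>Dyadic decomposition; the telescoping form of the bound serves both signs of \<open>c - e\<close>.\<close>
lemma sum_powr_annulus_le:
  fixes v g :: "'a \<Rightarrow> real"
  assumes fin: "finite T"
    and v: "\<And>i. i \<in> T \<Longrightarrow> 0 < v i" and g: "\<And>i. i \<in> T \<Longrightarrow> 0 \<le> g i"
    and B: "\<And>r. 0 < r \<Longrightarrow> (\<Sum>i | i \<in> T \<and> v i < r. g i) \<le> B * r powr c"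
    and e: "0 \<le> e" "e \<noteq> c" and a: "0 < a"
  shows "(\<Sum>i | i \<in> T \<and> a \<le> v i \<and> v i < 2 ^ n * a. g i * v i powr (- e))
    \<le> B * 2 powr c / (1 - 2 powr (c - e)) * (a powr (c - e) - (2 ^ n * a) powr (c - e))"
proof (induction n)
  case 0
  have "{i. i \<in> T \<and> a \<le> v i \<and> v i < a} = {}" by auto
  then show ?case by (simp only: power_0 mult_1 sum.empty) simp
next
  case (Suc n)
  define b where "b = 2 ^ n * a"
  have b: "0 < b" "a \<le> b" using a by (auto simp: b_def)
  let ?f = "\<lambda>i. g i * v i powr (- e)"
  have ne: "1 - 2 powr (c - e) \<noteq> (0::real)" using e by (simp add: powr_eq_one_iff_gen)
  have "(\<Sum>i | i \<in> T \<and> b \<le> v i \<and> v i < 2 * b. ?f i)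
      \<le> (\<Sum>i | i \<in> T \<and> b \<le> v i \<and> v i < 2 * b. g i * b powr (- e))"
    using b e by (intro sum_mono mult_left_mono) (auto simp: g powr_mono2')
  also have "\<dots> = (\<Sum>i | i \<in> T \<and> b \<le> v i \<and> v i < 2 * b. g i) * b powr (- e)"
    by (simp add: sum_distrib_right)
  also have "\<dots> \<le> (\<Sum>i | i \<in> T \<and> v i < 2 * b. g i) * b powr (- e)"
    using fin g by (intro mult_right_mono sum_mono2) auto
  also have "\<dots> \<le> B * (2 * b) powr c * b powr (- e)"
    using B[of "2 * b"] b by (intro mult_right_mono) auto
  also have "\<dots> = B * 2 powr c * b powr (c - e)"
    using b by (simp add: powr_mult powr_diff powr_minus field_simps)
  \<comment> \<open>The geometric term is a multiple of the difference of its values at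
    \<open>b\<close> and \<open>2 * b\<close>, so that successive shells telescope.\<close>
  also have "\<dots> = B * 2 powr c / (1 - 2 powr (c - e)) * (b powr (c - e) - (2 * b) powr (c - e))"
    using b ne by (simp add: powr_mult field_simps)
  finally have *: "(\<Sum>i | i \<in> T \<and> b \<le> v i \<and> v i < 2 * b. ?f i)
      \<le> B * 2 powr c / (1 - 2 powr (c - e)) * (b powr (c - e) - (2 * b) powr (c - e))" .
  have "{i. i \<in> T \<and> a \<le> v i \<and> v i < 2 * b} =
     {i. i \<in> T \<and> a \<le> v i \<and> v i < b} \<union> {i. i \<in> T \<and> b \<le> v i \<and> v i < 2 * b}"
    using b by auto
  then have "(\<Sum>i | i \<in> T \<and> a \<le> v i \<and> v i < 2 * b. ?f i) =
     (\<Sum>i | i \<in> T \<and> a \<le> v i \<and> v i < b. ?f i) + (\<Sum>i | i \<in> T \<and> b \<le> v i \<and> v i < 2 * b. ?f i)"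
    using fin by (simp only:) (rule sum.union_disjoint, auto)
  also have "\<dots> \<le> B * 2 powr c / (1 - 2 powr (c - e)) * (a powr (c - e) - b powr (c - e))
     + B * 2 powr c / (1 - 2 powr (c - e)) * (b powr (c - e) - (2 * b) powr (c - e))"
    using * Suc unfolding b_def by (intro add_mono) auto
  also have "\<dots> = B * 2 powr c / (1 - 2 powr (c - e)) * (a powr (c - e) - (2 * b) powr (c - e))"
    by (simp add: right_diff_distrib)
  finally show ?case by (simp add: b_def mult.assoc)
qed

lemma sum_powr_far_le:
  fixes v g :: "'a \<Rightarrow> real"
  assumes fin: "finite T"
    and v: "\<And>i. i \<in> T \<Longrightarrow> 0 < v i" and g: "\<And>i. i \<in> T \<Longrightarrow> 0 \<le> g i"
    and B: "\<And>r. 0 < r \<Longrightarrow> (\<Sum>i | i \<in> T \<and> v i < r. g i) \<le> B * r powr c" and B0: "0 \<le> B"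
    and e: "0 \<le> e" "c < e" and a: "0 < a"
  shows "(\<Sum>i | i \<in> T \<and> a \<le> v i. g i * v i powr (- e))
    \<le> B * 2 powr c / (1 - 2 powr (c - e)) * a powr (c - e)"
proof -
  obtain n where n: "(\<Sum>i\<in>T. v i) / a < 2 ^ n"
    using real_arch_pow[of 2] by auto
  have "v i < 2 ^ n * a" if "i \<in> T" for i
  proof -
    have "v i \<le> (\<Sum>i\<in>T. v i)"
      using that fin v by (intro member_le_sum) (auto intro: less_imp_le)
    then show ?thesis using n a by (simp add: field_simps)
  qed
  then have "{i. i \<in> T \<and> a \<le> v i} = {i. i \<in> T \<and> a \<le> v i \<and> v i < 2 ^ n * a}" by auto
  then have "(\<Sum>i | i \<in> T \<and> a \<le> v i. g i * v i powr (- e))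
    \<le> B * 2 powr c / (1 - 2 powr (c - e)) * (a powr (c - e) - (2 ^ n * a) powr (c - e))"
    using sum_powr_annulus_le[OF fin v g B e(1) _ a, where n=n] e by simp
  also have "\<dots> \<le> B * 2 powr c / (1 - 2 powr (c - e)) * a powr (c - e)"
  proof -
    have "2 powr (c - e) < 2 powr (0::real)" using e by (intro powr_less_mono) auto
    then show ?thesis using B0 by (intro mult_left_mono divide_nonneg_nonneg) auto
  qed
  finally show ?thesis .
qed

text \<open>Mirror image of the far case: a finite \<open>T\<close> stays above
  \<open>b / 2 ^ n\<close> for some \<open>n\<close>, and \<open>n\<close> doublings from there end
  exactly at \<open>b\<close>. Since \<open>e < c\<close>, numerator and denominator change sign,
  and now the inner term is the one to drop.\<close>

lemma sum_powr_near_le: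
  fixes v g :: "'a \<Rightarrow> real"
  assumes fin: "finite T"
    and v: "\<And>i. i \<in> T \<Longrightarrow> 0 < v i" and g: "\<And>i. i \<in> T \<Longrightarrow> 0 \<le> g i"
    and B: "\<And>r. 0 < r \<Longrightarrow> (\<Sum>i | i \<in> T \<and> v i < r. g i) \<le> B * r powr c" and B0: "0 \<le> B"
    and e: "0 \<le> e" "e < c" and b: "0 < b"
  shows "(\<Sum>i | i \<in> T \<and> v i < b. g i * v i powr (- e))
    \<le> B * 2 powr c / (2 powr (c - e) - 1) * b powr (c - e)"
proof -
  obtain n where n: "(\<Sum>i\<in>T. b / v i) < 2 ^ n"
    using real_arch_pow[of 2] by auto
  have n': "b / 2 ^ n \<le> v i" if "i \<in> T" for i
  proof -
    have "b / v i \<le> (\<Sum>i\<in>T. b / v i)"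
      using that fin v b by (intro member_le_sum) (auto intro!: divide_nonneg_pos)
    also have "\<dots> \<le> 2 ^ n" using n by simp
    finally show ?thesis using v[OF that] by (simp add: field_simps)
  qed
  have "{i. i \<in> T \<and> v i < b} = {i. i \<in> T \<and> b / 2 ^ n \<le> v i \<and> v i < 2 ^ n * (b / 2 ^ n)}"
    using n' by auto
  then have "(\<Sum>i | i \<in> T \<and> v i < b. g i * v i powr (- e))
    \<le> B * 2 powr c / (1 - 2 powr (c - e)) * ((b / 2 ^ n) powr (c - e) - b powr (c - e))"
    using sum_powr_annulus_le[OF fin v g B e(1), where n=n and a="b / 2 ^ n"] e b by simp
  also have "\<dots> = B * 2 powr c / (2 powr (c - e) - 1) * (b powr (c - e) - (b / 2 ^ n) powr (c - e))"
  proof -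
    have "X / (1 - Q) * (u - w) = X / (Q - 1) * (w - u)" if "Q \<noteq> 1" for X Q u w :: real
      using that by (simp add: divide_simps) (simp add: algebra_simps)
    then show ?thesis using e by (simp add: powr_eq_one_iff_gen)
  qed
  also have "\<dots> \<le> B * 2 powr c / (2 powr (c - e) - 1) * b powr (c - e)"
  proof -
    have "2 powr (0::real) < 2 powr (c - e)" using e by (intro powr_less_mono) auto
    then show ?thesis using B0 by (intro mult_left_mono divide_nonneg_nonneg) auto
  qed
  finally show ?thesis .
qed

section \<open>The maximum norm, cubes and balls of real radius\<close>

lemma inf_norm_minus_commute: "inf_norm (k - i) = inf_norm (i - k)"
  by (simp add: inf_norm_def abs_minus_commute)

lemma inf_norm_nonneg: "0 \<le> inf_norm x"
  using inf_norm_le_iff[of x "-1"] by (smt (verit, ccfv_SIG) abs_ge_zero inf_norm_le_iff)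

lemma inf_norm_pos: "i \<noteq> k \<Longrightarrow> 0 < inf_norm (k - i)"
  using inf_norm_le_iff[of "k - i" 0] inf_norm_nonneg[of "k - i"] by (force simp: vec_eq_iff)

lemma inf_norm_zero: "inf_norm (0 :: int ^ 'd) = 0"
  using inf_norm_le_iff[of "0 :: int ^ 'd" 0] inf_norm_nonneg[of "0 :: int ^ 'd"] by simp

lemma cube_trans: "k \<in> cube m N \<Longrightarrow> i \<in> cube k M \<Longrightarrow> i \<in> cube m (N + M)"
  unfolding cube_def mem_Collect_eq inf_norm_le_iff
  by (auto simp: abs_le_iff) (smt (verit))+

text \<open>Turns bounds on cubes of integer radius into the growth hypothesis of the dyadic lemmas,
  for every real radius. As \<open>k\<close> is not in \<open>T\<close>, all distances are at least
  1 and the case \<open>r \<le> 1\<close> is void; otherwise \<open>N\<close> is the floor of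
  \<open>r\<close> and \<open>2 * N + 1 \<le> 3 * r\<close>.\<close>

lemma sum_ball_le:
  fixes g :: "int ^ 'd \<Rightarrow> real"
  assumes fin: "finite T" and k: "k \<notin> T" and g: "\<And>i. 0 \<le> g i"
    and B: "\<And>N. (\<Sum>i\<in>cube k N. g i) \<le> B * real (2 * N + 1) powr c"
    and B0: "0 \<le> B" and c: "0 \<le> c" and r: "0 < r"
  shows "(\<Sum>i | i \<in> T \<and> real_of_int (inf_norm (k - i)) < r. g i) \<le> B * 3 powr c * r powr c"
proof (cases "r \<le> 1")
  case True
  have "{i. i \<in> T \<and> real_of_int (inf_norm (k - i)) < r} = {}"
  proof -
    have "1 \<le> real_of_int (inf_norm (k - i))" if "i \<in> T" for i
      using inf_norm_pos[of i k] k that by force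
    then show ?thesis using True by force
  qed
  then show ?thesis using B0 by (simp only: sum.empty) simp
next
  case False
  define N where "N = nat \<lfloor>r\<rfloor>"
  have N: "real N \<le> r" using r by (simp add: N_def)
  have "(\<Sum>i | i \<in> T \<and> real_of_int (inf_norm (k - i)) < r. g i) \<le> (\<Sum>i\<in>cube k N. g i)"
  proof (rule sum_mono2)
    show "{i \<in> T. real_of_int (inf_norm (k - i)) < r} \<subseteq> cube k N"
      using r by (auto simp: cube_def N_def inf_norm_minus_commute[of k] le_floor_iff)
  qed (auto simp: finite_cube g)
  also have "\<dots> \<le> B * real (2 * N + 1) powr c" by (rule B)
  also have "\<dots> \<le> B * (3 * r) powr c"
    using N False B0 c by (intro mult_left_mono powr_mono2) auto
  finally show ?thesis using r by (simp add: powr_mult mult.assoc)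
qed

section \<open>Nonnegative functions of Morrey norm at most one\<close>

text \<open>The Morrey inequality is raised to the power \<open>p\<close> and the cardinality of the
  cube, a power of its side, is moved to the right, so that neither supremum nor root
  remains.\<close>

definition morrey_unit :: "real \<Rightarrow> real \<Rightarrow> (int ^ 'd \<Rightarrow> real) \<Rightarrow> bool" where
  "morrey_unit p q y \<longleftrightarrow> (\<forall>i. 0 \<le> y i) \<and>
     (\<forall>m N. (\<Sum>k\<in>cube m N. y k powr p) \<le> real (2 * N + 1) powr (real CARD('d) * (1 - p / q)))"

lemma morrey_unit_nonneg: "morrey_unit p q y \<Longrightarrow> 0 \<le> y i"
  by (simp add: morrey_unit_def)

lemma morrey_unit_sum_powr:
  fixes y :: "int ^ 'd \<Rightarrow> real"
  shows "morrey_unit p q y \<Longrightarrow>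
    (\<Sum>k\<in>cube m N. y k powr p) \<le> real (2 * N + 1) powr (real CARD('d) * (1 - p / q))"
  by (simp add: morrey_unit_def)

text \<open>Provides the growth of the mass of \<open>y\<close> from which the tail of the potential
  is controlled.\<close>

lemma sum_cube_le:
  fixes y :: "int ^ 'd \<Rightarrow> real"
  assumes y: "morrey_unit p q y" and p: "1 < p" "p < q"
  shows "(\<Sum>k\<in>cube m N. y k) \<le> 2 * real (2 * N + 1) powr (real CARD('d) - real CARD('d) / q)"
proof -
  define d where "d = real CARD('d)"
  define L where "L = real (2 * N + 1)"
  \<comment> \<open>At this height the two bounds balance: values up to \<open>l\<close> contribute
    at most \<open>L powr d * l\<close>, and the larger ones, through their \<open>p\<close>-th
    powers, at most the same.\<close>
  define l where "l = L powr (- (d / q))"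
  have L: "0 < L" and l: "0 < l" by (auto simp: L_def l_def)
  \<comment> \<open>replaces Hoelder's inequality, at the cost of the factor 2\<close>
  have "y k \<le> l + l powr (1 - p) * y k powr p" for k
  proof (cases "y k \<le> l")
    case True
    then show ?thesis by (simp add: add_increasing2)
  next
    case False
    then have "y k = y k powr (1 - p) * y k powr p"
      using l by (simp flip: powr_add)
    also have "\<dots> \<le> l powr (1 - p) * y k powr p"
      using False l p by (intro mult_right_mono powr_mono2') auto
    finally show ?thesis using l by simp
  qed
  then have "(\<Sum>k\<in>cube m N. y k) \<le> (\<Sum>k\<in>cube m N. l + l powr (1 - p) * y k powr p)"
    by (intro sum_mono)
  also have "\<dots> = L powr d * l + l powr (1 - p) * (\<Sum>k\<in>cube m N. y k powr p)"
    using L by (simp add: sum.distrib sum_distrib_left card_cube d_def L_def powr_realpow)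
  also have "\<dots> \<le> L powr d * l + l powr (1 - p) * L powr (d * (1 - p / q))"
    using morrey_unit_sum_powr[OF y] by (intro add_left_mono mult_left_mono) (auto simp: d_def L_def)
  also have "l powr (1 - p) * L powr (d * (1 - p / q)) = L powr d * l"
    using p by (simp add: l_def powr_powr flip: powr_add) (simp add: field_simps)
  also have "L powr d * l = L powr (d - d / q)"
    by (simp add: l_def flip: powr_add)
  finally show ?thesis by (simp add: d_def L_def)
qed

section \<open>Tails of the potential and sums of the kernel\<close>

lemma riesz_term_eq:
  fixes x :: "int ^ 'd \<Rightarrow> real"
  shows "riesz_term \<alpha> x k i = x i * real_of_int (inf_norm (k - i)) powr (- (real CARD('d) - \<alpha>))"
  by (simp only: riesz_term_def powr_minus divide_inverse)

text \<open>The default values \<open>0 powr a = 0\<close> and \<open>a / 0 = 0\<close> make the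
  diagonal term vanish, so the excluded index may be added or removed freely.\<close>

lemma riesz_term_self: "riesz_term \<alpha> x k k = 0"
  by (simp add: riesz_term_def inf_norm_zero)

text \<open>The mass of \<open>y\<close> in a ball of radius \<open>r\<close> grows at most like
  \<open>r powr (d - d / q)\<close>, while the kernel decays with exponent
  \<open>d - \<alpha>\<close>. By \<open>q < d / \<alpha>\<close> the decay wins, with
  \<open>d / q - \<alpha>\<close> to spare.\<close>

lemma riesz_far:
  fixes \<alpha> p q :: real
  assumes "0 < \<alpha>" "\<alpha> < real CARD('d)" "1 < p" "p < q" "q < real CARD('d) / \<alpha>"
  obtains C where "0 < C"
    "\<And>(y :: int ^ 'd \<Rightarrow> real) k T R. morrey_unit p q y \<Longrightarrow> finite T \<Longrightarrow> k \<notin> T \<Longrightarrow> 0 < R \<Longrightarrow>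
       (\<Sum>i | i \<in> T \<and> R \<le> real_of_int (inf_norm (k - i)). riesz_term \<alpha> y k i)
         \<le> C * R powr (- (real CARD('d) / q - \<alpha>))"
proof -
  define d where "d = real CARD('d)"
  define c where "c = d - d / q"
  define e where "e = d - \<alpha>"
  have d: "0 < d" by (simp add: d_def)
  have c: "0 \<le> c" using assms d by (simp add: c_def field_simps)
  have ce: "c < e" "0 \<le> e" using assms d by (auto simp: c_def e_def d_def field_simps)
  define C where "C = 2 * 3 powr c * 2 powr c / (1 - 2 powr (c - e))"
  have "2 powr (c - e) < 2 powr (0::real)" using ce by (intro powr_less_mono) auto
  then have "0 < C" by (simp add: C_def)
  moreover have "(\<Sum>i | i \<in> T \<and> R \<le> real_of_int (inf_norm (k - i)). riesz_term \<alpha> y k i)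
       \<le> C * R powr (- (real CARD('d) / q - \<alpha>))"
    if y: "morrey_unit p q y" and T: "finite T" "k \<notin> T" and R: "0 < R"
    for y :: "int ^ 'd \<Rightarrow> real" and k T R
  proof -
    have "(\<Sum>i | i \<in> T \<and> R \<le> real_of_int (inf_norm (k - i)). y i * real_of_int (inf_norm (k - i)) powr (- e))
       \<le> 2 * 3 powr c * 2 powr c / (1 - 2 powr (c - e)) * R powr (c - e)"
    proof (rule sum_powr_far_le[OF T(1) _ _ _ _ ce(2,1) R])
      show "0 < real_of_int (inf_norm (k - i))" if "i \<in> T" for i
        using inf_norm_pos[of i k] that T by force
      show "(\<Sum>i | i \<in> T \<and> real_of_int (inf_norm (k - i)) < r. y i) \<le> 2 * 3 powr c * r powr c"
        if "0 < r" for r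
        by (rule sum_ball_le[OF T morrey_unit_nonneg[OF y] _ _ c that])
          (use sum_cube_le[OF y assms(3,4)] in \<open>auto simp: c_def d_def\<close>)
    qed (auto simp: morrey_unit_nonneg[OF y])
    moreover have "c - e = - (d / q - \<alpha>)" by (simp add: c_def e_def)
    ultimately show ?thesis
      unfolding riesz_term_eq C_def d_def[symmetric] e_def[symmetric] by (simp only:)
  qed
  ultimately show ?thesis by (rule that)
qed

lemma count_ball_le:
  fixes k :: "int ^ 'd"
  assumes "finite T" "k \<notin> T" "0 < r"
  shows "(\<Sum>i | i \<in> T \<and> real_of_int (inf_norm (k - i)) < r. 1) \<le> 3 powr real CARD('d) * r powr real CARD('d)"
proof -
  have "(\<Sum>i | i \<in> T \<and> real_of_int (inf_norm (k - i)) < r. 1)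
      \<le> 1 * 3 powr real CARD('d) * r powr real CARD('d)"
    by (rule sum_ball_le[OF assms(1,2) _ _ _ _ assms(3)]) (auto simp: card_cube powr_realpow)
  then show ?thesis by simp
qed

text \<open>The number of lattice points in a ball is at most a multiple of \<open>r powr d\<close>,
  so below the critical exponent \<open>d\<close> the outer radius governs the sum.\<close>

lemma kernel_near:
  fixes e :: real
  assumes e: "0 \<le> e" "e < real CARD('d)"
  obtains C where "0 < C"
    "\<And>(k :: int ^ 'd) T R. finite T \<Longrightarrow> k \<notin> T \<Longrightarrow> 0 < R \<Longrightarrow>
       (\<Sum>i | i \<in> T \<and> real_of_int (inf_norm (k - i)) < R. real_of_int (inf_norm (k - i)) powr (- e))
         \<le> C * R powr (real CARD('d) - e)"
proof -
  define d where "d = real CARD('d)"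
  define C where "C = 3 powr d * 2 powr d / (2 powr (d - e) - 1)"
  have "2 powr 0 < 2 powr (d - e)" using e by (intro powr_less_mono) (auto simp: d_def)
  then have "0 < C" by (simp add: C_def)
  moreover have "(\<Sum>i | i \<in> T \<and> real_of_int (inf_norm (k - i)) < R. real_of_int (inf_norm (k - i)) powr (- e))
         \<le> C * R powr (real CARD('d) - e)"
    if T: "finite T" "k \<notin> T" and R: "0 < R" for k :: "int ^ 'd" and T R
  proof -
    have "(\<Sum>i | i \<in> T \<and> real_of_int (inf_norm (k - i)) < R. 1 * real_of_int (inf_norm (k - i)) powr (- e))
         \<le> 3 powr d * 2 powr d / (2 powr (d - e) - 1) * R powr (d - e)"
    proof (rule sum_powr_near_le[OF T(1) _ _ _ _ e(1) _ R])
      show "0 < real_of_int (inf_norm (k - i))" if "i \<in> T" for i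
        using inf_norm_pos[of i k] that T by force
      show "(\<Sum>i | i \<in> T \<and> real_of_int (inf_norm (k - i)) < r. 1) \<le> 3 powr d * r powr d"
        if "0 < r" for r
        using count_ball_le[OF T that] by (simp add: d_def)
    qed (use e in \<open>auto simp: d_def\<close>)
    then show ?thesis by (simp add: C_def d_def)
  qed
  ultimately show ?thesis by (rule that)
qed

text \<open>Above the critical exponent the inner radius governs the sum.\<close>

lemma kernel_far:
  fixes e :: real
  assumes e: "real CARD('d) < e"
  obtains C where "0 < C"
    "\<And>(k :: int ^ 'd) T R. finite T \<Longrightarrow> k \<notin> T \<Longrightarrow> 0 < R \<Longrightarrow>
       (\<Sum>i | i \<in> T \<and> R \<le> real_of_int (inf_norm (k - i)). real_of_int (inf_norm (k - i)) powr (- e))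
         \<le> C * R powr (real CARD('d) - e)"
proof -
  define d where "d = real CARD('d)"
  define C where "C = 3 powr d * 2 powr d / (1 - 2 powr (d - e))"
  have "2 powr (d - e) < 2 powr 0" using e by (intro powr_less_mono) (auto simp: d_def)
  then have "0 < C" by (simp add: C_def)
  moreover have "(\<Sum>i | i \<in> T \<and> R \<le> real_of_int (inf_norm (k - i)). real_of_int (inf_norm (k - i)) powr (- e))
         \<le> C * R powr (real CARD('d) - e)"
    if T: "finite T" "k \<notin> T" and R: "0 < R" for k :: "int ^ 'd" and T R
  proof -
    have "(\<Sum>i | i \<in> T \<and> R \<le> real_of_int (inf_norm (k - i)). 1 * real_of_int (inf_norm (k - i)) powr (- e))
         \<le> 3 powr d * 2 powr d / (1 - 2 powr (d - e)) * R powr (d - e)"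
    proof (rule sum_powr_far_le[OF T(1) _ _ _ _ _ _ R])
      show "0 < real_of_int (inf_norm (k - i))" if "i \<in> T" for i
        using inf_norm_pos[of i k] that T by force
      show "(\<Sum>i | i \<in> T \<and> real_of_int (inf_norm (k - i)) < r. 1) \<le> 3 powr d * r powr d"
        if "0 < r" for r
        using count_ball_le[OF T that] by (simp add: d_def)
      show "0 \<le> e" using e by linarith
    qed (use e in \<open>auto simp: d_def\<close>)
    then show ?thesis by (simp add: C_def d_def)
  qed
  ultimately show ?thesis by (rule that)
qed

text \<open>Inside radius \<open>\<sigma>\<close> the second factor is constant and the kernel alone
  sums to order \<open>\<sigma> powr \<alpha>\<close>. Outside, the factors merge into the exponent
  \<open>d - \<alpha> + \<delta>\<close>, which exceeds \<open>d\<close> because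
  \<open>\<alpha> < \<delta>\<close>.\<close>

lemma kernel_truncated:
  fixes \<alpha> \<delta> :: real
  assumes \<alpha>: "0 < \<alpha>" "\<alpha> < real CARD('d)" "\<alpha> < \<delta>"
  obtains C where "0 < C"
    "\<And>(k :: int ^ 'd) T \<sigma>. finite T \<Longrightarrow> k \<notin> T \<Longrightarrow> 0 < \<sigma> \<Longrightarrow>
       (\<Sum>i\<in>T. real_of_int (inf_norm (k - i)) powr (- (real CARD('d) - \<alpha>)) *
          max (real_of_int (inf_norm (k - i))) \<sigma> powr (- \<delta>)) \<le> C * \<sigma> powr (\<alpha> - \<delta>)"
proof -
  define d where "d = real CARD('d)"
  obtain A where A: "0 < A"
    "\<And>(k :: int ^ 'd) T R. finite T \<Longrightarrow> k \<notin> T \<Longrightarrow> 0 < R \<Longrightarrow>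
       (\<Sum>i | i \<in> T \<and> real_of_int (inf_norm (k - i)) < R. real_of_int (inf_norm (k - i)) powr (- (d - \<alpha>)))
         \<le> A * R powr (d - (d - \<alpha>))"
    using kernel_near[where 'd='d, of "d - \<alpha>"] \<alpha> unfolding d_def by (smt (verit))
  obtain B where B: "0 < B"
    "\<And>(k :: int ^ 'd) T R. finite T \<Longrightarrow> k \<notin> T \<Longrightarrow> 0 < R \<Longrightarrow>
       (\<Sum>i | i \<in> T \<and> R \<le> real_of_int (inf_norm (k - i)). real_of_int (inf_norm (k - i)) powr (- (d - \<alpha> + \<delta>)))
         \<le> B * R powr (d - (d - \<alpha> + \<delta>))"
    using kernel_far[where 'd='d, of "d - \<alpha> + \<delta>"] \<alpha> unfolding d_def by (smt (verit))
  have "(\<Sum>i\<in>T. real_of_int (inf_norm (k - i)) powr (- (d - \<alpha>)) *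
          max (real_of_int (inf_norm (k - i))) \<sigma> powr (- \<delta>)) \<le> (A + B) * \<sigma> powr (\<alpha> - \<delta>)"
    if T: "finite T" "k \<notin> T" and \<sigma>: "0 < \<sigma>" for k :: "int ^ 'd" and T \<sigma>
  proof -
    define v where "v i = real_of_int (inf_norm (k - i))" for i
    have "(\<Sum>i\<in>T. v i powr (- (d - \<alpha>)) * max (v i) \<sigma> powr (- \<delta>)) =
      (\<Sum>i\<in>{i. i \<in> T \<and> v i < \<sigma>} \<union> {i. i \<in> T \<and> \<sigma> \<le> v i}. v i powr (- (d - \<alpha>)) * max (v i) \<sigma> powr (- \<delta>))"
      by (rule sum.cong) auto
    also have "\<dots> =
      (\<Sum>i | i \<in> T \<and> v i < \<sigma>. v i powr (- (d - \<alpha>)) * max (v i) \<sigma> powr (- \<delta>)) +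
      (\<Sum>i | i \<in> T \<and> \<sigma> \<le> v i. v i powr (- (d - \<alpha>)) * max (v i) \<sigma> powr (- \<delta>))"
      using T by (intro sum.union_disjoint) auto
    also have "(\<Sum>i | i \<in> T \<and> v i < \<sigma>. v i powr (- (d - \<alpha>)) * max (v i) \<sigma> powr (- \<delta>)) =
      (\<Sum>i | i \<in> T \<and> v i < \<sigma>. v i powr (- (d - \<alpha>))) * \<sigma> powr (- \<delta>)"
      unfolding sum_distrib_right by (intro sum.cong) (auto simp: max_def)
    also have "(\<Sum>i | i \<in> T \<and> \<sigma> \<le> v i. v i powr (- (d - \<alpha>)) * max (v i) \<sigma> powr (- \<delta>)) =
      (\<Sum>i | i \<in> T \<and> \<sigma> \<le> v i. v i powr (- (d - \<alpha> + \<delta>)))"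
      by (intro sum.cong) (auto simp: max_def simp flip: powr_add)
    also have "(\<Sum>i | i \<in> T \<and> v i < \<sigma>. v i powr (- (d - \<alpha>))) * \<sigma> powr (- \<delta>) \<le>
        A * \<sigma> powr (d - (d - \<alpha>)) * \<sigma> powr (- \<delta>)"
      using A(2)[OF T \<sigma>] by (intro mult_right_mono) (auto simp: v_def)
    also have "\<dots> = A * \<sigma> powr (\<alpha> - \<delta>)" by (simp add: mult.assoc flip: powr_add)
    also have "(\<Sum>i | i \<in> T \<and> \<sigma> \<le> v i. v i powr (- (d - \<alpha> + \<delta>))) \<le> B * \<sigma> powr (\<alpha> - \<delta>)"
      using B(2)[OF T \<sigma>] by (simp add: v_def)
    finally show ?thesis by (simp add: v_def distrib_right)
  qed
  then show ?thesis using A(1) B(1) by (intro that[of "A + B"]) (auto simp: d_def)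
qed

section \<open>Pointwise bound for a power of the potential\<close>

text \<open>A sum of at most \<open>4 * A * M powr (- \<beta>)\<close> is absorbed by the first
  summand. A larger one forces \<open>R < M\<close>; then one factor of its \<open>s\<close>-th
  power is expanded into the sum over the remaining points, and the power \<open>s - 1\<close> is
  expressed through \<open>R\<close>.\<close>

lemma riesz_pointwise_dichotomy:
  fixes y :: "int ^ 'd \<Rightarrow> real"
  defines "d \<equiv> real CARD('d)"
  assumes \<alpha>: "0 < \<alpha>" "\<alpha> < d" and q: "0 < q" and \<beta>: "\<beta> = d / q - \<alpha>" "0 < \<beta>" and s: "1 \<le> s"
    and y: "\<And>i. 0 \<le> y i" and T: "finite T" "k \<notin> T" and A: "0 < A" and B: "0 < B"
    and far: "\<And>R. 0 < R \<Longrightarrow> (\<Sum>i | i \<in> T \<and> R \<le> real_of_int (inf_norm (k - i)). riesz_term \<alpha> y k i)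
       \<le> A * R powr (- \<beta>)"
    and near: "\<And>R. 0 < R \<Longrightarrow> (\<Sum>i | i \<in> T \<and> real_of_int (inf_norm (k - i)) < R.
        real_of_int (inf_norm (k - i)) powr (- (d - \<alpha>))) \<le> B * R powr \<alpha>"
    and M: "0 < M"
  shows "(\<Sum>i\<in>T. riesz_term \<alpha> y k i) powr s \<le> (4 * A * M powr (- \<beta>)) powr s +
    2 * (4 * A) powr (s - 1) *
      (\<Sum>i | i \<in> T \<and> 0 < y i \<and> real_of_int (inf_norm (k - i)) < M. riesz_term \<alpha> y k i *
        max (real_of_int (inf_norm (k - i))) ((y i * B / A) powr (- (q / d))) powr (- (\<beta> * (s - 1))))"
    (is "?F powr s \<le> ?X + 2 * ?c * (\<Sum>i | ?P i. ?g i)")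
proof -
  define v where "v i = real_of_int (inf_norm (k - i))" for i
  define \<sigma> where "\<sigma> i = (y i * B / A) powr (- (q / d))" for i
  define F where "F = ?F"
  have d: "0 < d" using \<alpha> by simp
  have rt: "riesz_term \<alpha> y k i = y i * v i powr (- (d - \<alpha>))" for i
    by (simp add: riesz_term_eq v_def d_def)
  have rt0: "0 \<le> riesz_term \<alpha> y k i" for i by (simp add: rt y)
  have F0: "0 \<le> F" by (simp add: F_def sum_nonneg rt0)
  have g0: "0 \<le> 2 * ?c * (\<Sum>i | ?P i. ?g i)"
    by (intro mult_nonneg_nonneg sum_nonneg rt0) auto
  show ?thesis
  proof (cases "F \<le> 4 * A * M powr (- \<beta>)")
    case True
    then have "F powr s \<le> ?X" using F0 s by (intro powr_mono2) auto
    then show ?thesis using g0 by (simp add: F_def)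
  next
    case False
    have "0 < 4 * A * M powr (- \<beta>)" using A M by simp
    with False have Fpos: "0 < F" by linarith
    \<comment> \<open>Solves \<open>F = 4 * A * R powr (- \<beta>)\<close>, so that the tail bound
      at radius \<open>R\<close> equals \<open>F / 4\<close>.\<close>
    define R where "R = (F / (4 * A)) powr (- (1 / \<beta>))"
    have R: "0 < R" using Fpos A by (simp add: R_def)
    have FR: "F = 4 * A * R powr (- \<beta>)"
      using Fpos A \<beta>(2) by (simp add: R_def powr_powr)
    have RM: "R < M"
    proof (rule ccontr)
      assume "\<not> R < M"
      then have "R powr (- \<beta>) \<le> M powr (- \<beta>)" using M \<beta> by (intro powr_mono2') auto
      then show False using False A by (simp add: FR)
    qed
    \<comment> \<open>The height for which the near bound gives \<open>\<eta> * (B * R powr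
      \<alpha>) = A * R powr (- \<beta>) = F / 4\<close>.\<close>
    define \<eta> where "\<eta> = A / B * R powr (- (d / q))"
    have \<eta>: "0 < \<eta>" using A B R by (simp add: \<eta>_def)
    let ?G = "{i. i \<in> T \<and> v i < R \<and> \<eta> < y i}"
    let ?S = "{i. i \<in> T \<and> v i < R \<and> y i \<le> \<eta>}"
    let ?H = "{i. i \<in> T \<and> R \<le> v i}"
    have "F = sum (riesz_term \<alpha> y k) (?G \<union> (?S \<union> ?H))"
      unfolding F_def by (rule sum.cong) auto
    also have "\<dots> = sum (riesz_term \<alpha> y k) ?G + sum (riesz_term \<alpha> y k) (?S \<union> ?H)"
      using T by (intro sum.union_disjoint) auto
    also have "sum (riesz_term \<alpha> y k) (?S \<union> ?H) = sum (riesz_term \<alpha> y k) ?S + sum (riesz_term \<alpha> y k) ?H"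
      using T by (intro sum.union_disjoint) auto
    also have "sum (riesz_term \<alpha> y k) ?H \<le> F / 4"
      using far[OF R] by (simp add: FR v_def)
    also have "sum (riesz_term \<alpha> y k) ?S \<le> F / 4"
    proof -
      have "sum (riesz_term \<alpha> y k) ?S \<le> (\<Sum>i\<in>?S. \<eta> * v i powr (- (d - \<alpha>)))"
        unfolding rt by (intro sum_mono mult_right_mono) auto
      also have "\<dots> \<le> (\<Sum>i | i \<in> T \<and> v i < R. \<eta> * v i powr (- (d - \<alpha>)))"
        using T \<eta> by (intro sum_mono2) auto
      also have "\<dots> = \<eta> * (\<Sum>i | i \<in> T \<and> v i < R. v i powr (- (d - \<alpha>)))"
        by (simp add: sum_distrib_left)
      also have "\<dots> \<le> \<eta> * (B * R powr \<alpha>)"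
        using near[OF R] \<eta> by (intro mult_left_mono) (auto simp: v_def)
      also have "\<dots> = A * (R powr (- (d / q)) * R powr \<alpha>)" using B by (simp add: \<eta>_def)
      also have "\<dots> = F / 4" by (simp add: FR \<beta> flip: powr_add)
      finally show ?thesis .
    qed
    finally have FG: "F \<le> 2 * sum (riesz_term \<alpha> y k) ?G" by simp
    have "F powr s = F powr 1 * F powr (s - 1)" by (subst powr_add[symmetric]) simp
    also have "\<dots> = F * F powr (s - 1)" using Fpos by simp
    also have "\<dots> \<le> 2 * sum (riesz_term \<alpha> y k) ?G * F powr (s - 1)"
      using FG by (intro mult_right_mono) auto
    also have "F powr (s - 1) = ?c * R powr (- (\<beta> * (s - 1)))"
      unfolding FR using A by (simp add: powr_mult powr_powr)
    also have "2 * sum (riesz_term \<alpha> y k) ?G * (?c * R powr (- (\<beta> * (s - 1)))) =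
       2 * ?c * (\<Sum>i\<in>?G. riesz_term \<alpha> y k i * R powr (- (\<beta> * (s - 1))))"
      by (simp only: sum_distrib_right[symmetric] mult_ac)
    also have "\<dots> \<le> 2 * ?c * (\<Sum>i\<in>?G. ?g i)"
    proof (intro mult_left_mono sum_mono rt0)
      fix i assume i: "i \<in> ?G"
      \<comment> \<open>This is \<open>\<eta> < y i\<close> solved for \<open>R\<close>; the
        negative exponent \<open>- (q / d)\<close> reverses the inequality. It removes
        \<open>R\<close>, which depends on the whole sum \<open>F\<close>, from the bound.\<close>
      have "\<sigma> i \<le> R"
      proof -
        have "R powr (- (d / q)) \<le> y i * B / A"
          using i A B by (simp add: \<eta>_def field_simps)
        then have "(y i * B / A) powr (- (q / d)) \<le> (R powr (- (d / q))) powr (- (q / d))"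
          using R q d by (intro powr_mono2') auto
        also have "\<dots> = R" using R q d by (simp add: powr_powr)
        finally show ?thesis by (simp add: \<sigma>_def)
      qed
      moreover have "0 < v i" unfolding v_def using inf_norm_pos[of i k] i T by auto
      ultimately have "R powr (- (\<beta> * (s - 1))) \<le> max (v i) (\<sigma> i) powr (- (\<beta> * (s - 1)))"
        using i \<beta> s by (intro powr_mono2') auto
      then show "R powr (- (\<beta> * (s - 1))) \<le> max (real_of_int (inf_norm (k - i)))
          ((y i * B / A) powr (- (q / d))) powr (- (\<beta> * (s - 1)))"
        by (simp add: v_def \<sigma>_def)
    qed auto
    also have "\<dots> \<le> 2 * ?c * (\<Sum>i | ?P i. ?g i)"
    proof (intro mult_left_mono sum_mono2)
      show "?G \<subseteq> {i. ?P i}" using \<eta> RM by (auto simp: v_def)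
    qed (auto simp: T intro!: mult_nonneg_nonneg rt0)
    finally have "F powr s \<le> 2 * ?c * (\<Sum>i | ?P i. ?g i)" .
    then show ?thesis unfolding F_def by (rule add_increasing[rotated]) simp
  qed
qed

section \<open>Summation over a cube, uniformly in the finite index set\<close>

text \<open>The pointwise bound is summed over the cube. Its first summand is constant in
  \<open>k\<close>; in the second the order of summation is exchanged, and the kernel sum over
  \<open>k\<close> leaves \<open>p\<close>-th powers of \<open>y\<close> on an enlarged cube. That
  \<open>C\<close> does not depend on \<open>T\<close> permits the later limit.\<close>

lemma riesz_finite_sum_powr_le:
  fixes \<alpha> p q s :: real
  assumes \<alpha>: "0 < \<alpha>" "\<alpha> < real CARD('d)" and p: "1 < p" "p < q" and q: "q < real CARD('d) / \<alpha>"
    and s: "s = real CARD('d) * p / (real CARD('d) - \<alpha> * q)"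
  obtains C where "0 < C"
    "\<And>(y :: int ^ 'd \<Rightarrow> real) T m N. morrey_unit p q y \<Longrightarrow> finite T \<Longrightarrow>
       (\<Sum>k\<in>cube m N. (\<Sum>i\<in>T. riesz_term \<alpha> y k i) powr s)
         \<le> C * real (2 * N + 1) powr (real CARD('d) * (1 - p / q))"
proof -
  define d where "d = real CARD('d)"
  define \<beta> where "\<beta> = d / q - \<alpha>"
  define \<delta> where "\<delta> = \<beta> * (s - 1)"
  have d: "0 < d" by (simp add: d_def)
  have q0: "0 < q" and p0: "0 < p" using p by auto
  have "\<alpha> * q < d" using q \<alpha> by (simp add: d_def field_simps)
  then have \<beta>: "0 < \<beta>" using q0 by (simp add: \<beta>_def field_simps)
  \<comment> \<open>The value of \<open>s\<close> enters here: it makes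
    \<open>L powr d * L powr (- (\<beta> * s))\<close> exactly the growth \<open>L powr E\<close>
    allowed for \<open>y\<close>.\<close>
  have \<beta>s: "\<beta> * s = d * p / q"
    using \<open>\<alpha> * q < d\<close> q0 unfolding s \<beta>_def d_def[symmetric] by (simp add: field_simps)
  have "1 \<le> s"
  proof -
    have "\<beta> * 1 \<le> d / q" using \<alpha> by (simp add: \<beta>_def)
    also have "\<dots> \<le> \<beta> * s" unfolding \<beta>s using p d q0 by (simp add: field_simps)
    finally show ?thesis using \<beta> by simp
  qed
  \<comment> \<open>As \<open>\<sigma> i\<close> is a multiple of
    \<open>y i powr (- (q / d))\<close>, this exponent turns
    \<open>\<sigma> i powr (\<alpha> - \<delta>)\<close> into a multiple of
    \<open>y i powr (p - 1)\<close>. It is negative because \<open>1 < p\<close>.\<close>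
  have \<alpha>\<delta>: "\<alpha> - \<delta> = - (d / q) * (p - 1)"
    by (simp add: \<delta>_def right_diff_distrib \<beta>s) (simp add: \<beta>_def)
  have "\<alpha> < \<delta>"
  proof -
    have "0 < d / q * (p - 1)" using d q0 p by simp
    then show ?thesis using \<alpha>\<delta> by simp
  qed
  obtain A where A: "0 < A"
    "\<And>(y :: int ^ 'd \<Rightarrow> real) k T R. morrey_unit p q y \<Longrightarrow> finite T \<Longrightarrow> k \<notin> T \<Longrightarrow> 0 < R \<Longrightarrow>
       (\<Sum>i | i \<in> T \<and> R \<le> real_of_int (inf_norm (k - i)). riesz_term \<alpha> y k i) \<le> A * R powr (- \<beta>)"
    using riesz_far[OF \<alpha> p q] unfolding \<beta>_def d_def by blast
  obtain B where B: "0 < B"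
    "\<And>(k :: int ^ 'd) T R. finite T \<Longrightarrow> k \<notin> T \<Longrightarrow> 0 < R \<Longrightarrow>
       (\<Sum>i | i \<in> T \<and> real_of_int (inf_norm (k - i)) < R. real_of_int (inf_norm (k - i)) powr (- (d - \<alpha>)))
         \<le> B * R powr (d - (d - \<alpha>))"
    using kernel_near[where 'd='d, of "d - \<alpha>"] \<alpha> unfolding d_def by (smt (verit))
  obtain K where K: "0 < K"
    "\<And>(k :: int ^ 'd) T \<sigma>. finite T \<Longrightarrow> k \<notin> T \<Longrightarrow> 0 < \<sigma> \<Longrightarrow>
       (\<Sum>i\<in>T. real_of_int (inf_norm (k - i)) powr (- (d - \<alpha>)) *
          max (real_of_int (inf_norm (k - i))) \<sigma> powr (- \<delta>)) \<le> K * \<sigma> powr (\<alpha> - \<delta>)"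
    using kernel_truncated[where 'd='d, OF \<alpha> \<open>\<alpha> < \<delta>\<close>] unfolding d_def by blast
  define E where "E = d * (1 - p / q)"
  have E: "0 \<le> E" using d p q0 by (simp add: E_def)
  define C1 where "C1 = (4 * A) powr s * 2 powr (d * p / q)"
  define C2 where "C2 = 2 * (4 * A) powr (s - 1)"
  define C3 where "C3 = K * (B / A) powr (p - 1)"
  have C: "0 < C1" "0 < C2" "0 < C3" using A(1) B(1) K(1) by (auto simp: C1_def C2_def C3_def)
  have "(\<Sum>k\<in>cube m N. (\<Sum>i\<in>T. riesz_term \<alpha> y k i) powr s)
      \<le> (C1 + C2 * C3 * 3 powr E) * real (2 * N + 1) powr E"
    if y: "morrey_unit p q y" and T: "finite T" for y :: "int ^ 'd \<Rightarrow> real" and T m N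
  proof -
    define L where "L = real (2 * N + 1)"
    have L: "0 < L" by (simp add: L_def)
    \<comment> \<open>Taking \<open>N + 1\<close> instead of \<open>N\<close> keeps \<open>M\<close>
      positive for \<open>N = 0\<close> and at least \<open>L / 2\<close>.\<close>
    define M where "M = real N + 1"
    define v where "v k i = real_of_int (inf_norm (k - i))" for k i :: "int ^ 'd"
    define \<sigma> where "\<sigma> i = (y i * B / A) powr (- (q / d))" for i
    \<comment> \<open>Contains every relevant point at distance below \<open>M\<close> from the
      original cube, whatever \<open>T\<close> is. Positivity of \<open>y i\<close> ensures
      \<open>0 < \<sigma> i\<close>.\<close>
    define U where "U = {i. i \<in> cube m (2 * N + 1) \<and> 0 < y i}"
    define w where "w k i = v k i powr (- (d - \<alpha>)) * max (v k i) (\<sigma> i) powr (- \<delta>)" for k i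
    have U: "finite U" by (simp add: U_def finite_cube)
    have y0: "0 \<le> y i" for i using y by (rule morrey_unit_nonneg)
    have rt: "riesz_term \<alpha> y k i = y i * v k i powr (- (d - \<alpha>))" for k i
      by (simp add: riesz_term_eq v_def d_def)
    have w0: "0 \<le> w k i" for k i by (simp add: w_def)
    have "(\<Sum>i\<in>T. riesz_term \<alpha> y k i) powr s \<le> (4 * A * M powr (- \<beta>)) powr s + C2 * (\<Sum>i\<in>U. y i * w k i)"
      if k: "k \<in> cube m N" for k
    proof -
      have "(\<Sum>i\<in>T. riesz_term \<alpha> y k i) = (\<Sum>i\<in>T - {k}. riesz_term \<alpha> y k i)"
        using T by (intro sum.mono_neutral_right) (auto simp: riesz_term_self)
      also have "\<dots> powr s \<le> (4 * A * M powr (- \<beta>)) powr s + 2 * (4 * A) powr (s - 1) *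
         (\<Sum>i | i \<in> T - {k} \<and> 0 < y i \<and> real_of_int (inf_norm (k - i)) < M. riesz_term \<alpha> y k i *
           max (real_of_int (inf_norm (k - i))) ((y i * B / A) powr (- (q / real CARD('d)))) powr (- (\<beta> * (s - 1))))"
      proof (rule riesz_pointwise_dichotomy[OF \<alpha> q0 _ \<beta> \<open>1 \<le> s\<close> y0 _ _ A(1) B(1)])
        show "(\<Sum>i | i \<in> T - {k} \<and> real_of_int (inf_norm (k - i)) < R.
          real_of_int (inf_norm (k - i)) powr - (real CARD('d) - \<alpha>)) \<le> B * R powr \<alpha>" if "0 < R" for R
          using B(2)[of "T - {k}" k R] T that by (simp add: d_def)
        show "\<beta> = real CARD('d) / q - \<alpha>" by (simp add: \<beta>_def d_def)
        show "0 < M" by (simp add: M_def)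
      qed (use A(2)[OF y, of "T - {k}" k] T in auto)
      also have "(\<Sum>i | i \<in> T - {k} \<and> 0 < y i \<and> real_of_int (inf_norm (k - i)) < M. riesz_term \<alpha> y k i *
           max (real_of_int (inf_norm (k - i))) ((y i * B / A) powr (- (q / real CARD('d)))) powr (- (\<beta> * (s - 1))))
         = (\<Sum>i | i \<in> T - {k} \<and> 0 < y i \<and> v k i < M. y i * w k i)"
        unfolding rt w_def v_def[symmetric] \<sigma>_def \<delta>_def d_def by (simp only: mult.assoc)
      also have "\<dots> \<le> (\<Sum>i\<in>U. y i * w k i)"
      proof (rule sum_mono2[OF U])
        show "{i. i \<in> T - {k} \<and> 0 < y i \<and> v k i < M} \<subseteq> U"
        proof
          fix i assume "i \<in> {i. i \<in> T - {k} \<and> 0 < y i \<and> v k i < M}"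
          then have i: "0 < y i" "v k i < M" by auto
          then have "inf_norm (k - i) \<le> int (N + 1)"
            by (simp add: v_def M_def)
          then have "i \<in> cube k (N + 1)" by (simp add: cube_def inf_norm_minus_commute[of i])
          then have "i \<in> cube m (N + (N + 1))" by (rule cube_trans[OF k])
          then show "i \<in> U" using i by (simp add: U_def mult_2)
        qed
      qed (auto intro!: mult_nonneg_nonneg w0 y0)
      finally show ?thesis using C by (simp add: C2_def)
    qed
    then have "(\<Sum>k\<in>cube m N. (\<Sum>i\<in>T. riesz_term \<alpha> y k i) powr s)
        \<le> (\<Sum>k\<in>cube m N. (4 * A * M powr (- \<beta>)) powr s + C2 * (\<Sum>i\<in>U. y i * w k i))"
      by (intro sum_mono)
    also have "\<dots> = L powr d * (4 * A * M powr (- \<beta>)) powr s + C2 * (\<Sum>i\<in>U. y i * (\<Sum>k\<in>cube m N. w k i))"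
      using L by (simp add: sum.distrib card_cube L_def d_def powr_realpow sum_distrib_left
        sum.swap[of _ "cube m N"])
    also have "L powr d * (4 * A * M powr (- \<beta>)) powr s \<le> C1 * L powr E"
    proof -
      have "M powr (- (d * p / q)) \<le> (L / 2) powr (- (d * p / q))"
        using d p0 q0 by (intro powr_mono2') (auto simp: L_def M_def)
      also have "\<dots> = 2 powr (d * p / q) * L powr (- (d * p / q))"
        using L by (simp add: powr_divide powr_minus field_simps)
      finally have *: "M powr (- (d * p / q)) \<le> 2 powr (d * p / q) * L powr (- (d * p / q))" .
      have "(4 * A * M powr (- \<beta>)) powr s = (4 * A) powr s * M powr (- (d * p / q))"
        using A(1) \<beta>s by (simp add: powr_mult powr_powr M_def)
      also have "\<dots> \<le> (4 * A) powr s * (2 powr (d * p / q) * L powr (- (d * p / q)))"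
        using * by (intro mult_left_mono) auto
      finally have "L powr d * (4 * A * M powr (- \<beta>)) powr s
          \<le> L powr d * ((4 * A) powr s * (2 powr (d * p / q) * L powr (- (d * p / q))))"
        by (intro mult_left_mono) auto
      also have "\<dots> = C1 * (L powr d * L powr (- (d * p / q)))" by (simp add: C1_def)
      also have "\<dots> = C1 * L powr E" by (simp add: E_def right_diff_distrib flip: powr_add)
      finally show ?thesis .
    qed
    \<comment> \<open>For fixed \<open>i\<close> the radius \<open>\<sigma> i\<close> does not vary
      with \<open>k\<close>, so the truncated kernel sum applies with centre \<open>i\<close>; the
      term \<open>k = i\<close> is zero by \<open>0 powr a = 0\<close>.\<close>
    also have "(\<Sum>i\<in>U. y i * (\<Sum>k\<in>cube m N. w k i)) \<le> (\<Sum>i\<in>U. C3 * y i powr p)"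
    proof (rule sum_mono)
      fix i assume i: "i \<in> U"
      then have yi: "0 < y i" by (simp add: U_def)
      have \<sigma>: "0 < \<sigma> i" using yi A(1) B(1) by (simp add: \<sigma>_def)
      have "(\<Sum>k\<in>cube m N. w k i) = (\<Sum>k\<in>cube m N - {i}. w k i)"
        by (intro sum.mono_neutral_right) (auto simp: finite_cube w_def v_def inf_norm_zero)
      also have "\<dots> \<le> K * \<sigma> i powr (\<alpha> - \<delta>)"
        using K(2)[of "cube m N - {i}" i "\<sigma> i"] \<sigma>
        by (simp add: finite_cube w_def v_def inf_norm_minus_commute[of i])
      also have "\<sigma> i powr (\<alpha> - \<delta>) = (y i * B / A) powr (p - 1)"
      proof -
        have "- (q / d) * (\<alpha> - \<delta>) = p - 1" using d q0 by (simp add: \<alpha>\<delta>)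
        then show ?thesis by (simp only: \<sigma>_def powr_powr)
      qed
      also have "\<dots> = (B / A) powr (p - 1) * y i powr (p - 1)"
        using yi A(1) B(1) by (simp add: powr_mult powr_divide)
      finally have "y i * (\<Sum>k\<in>cube m N. w k i) \<le> y i * (C3 * y i powr (p - 1))"
        using yi by (intro mult_left_mono) (auto simp: C3_def)
      also have "\<dots> = C3 * (y i powr 1 * y i powr (p - 1))" using yi by simp
      also have "\<dots> = C3 * y i powr p" by (subst powr_add[symmetric]) simp
      finally show "y i * (\<Sum>k\<in>cube m N. w k i) \<le> C3 * y i powr p" .
    qed
    also have "(\<Sum>i\<in>U. C3 * y i powr p) \<le> C3 * (\<Sum>i\<in>cube m (2 * N + 1). y i powr p)"
      unfolding sum_distrib_left using C by (intro sum_mono2) (auto simp: finite_cube U_def)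
    also have "(\<Sum>i\<in>cube m (2 * N + 1). y i powr p) \<le> real (2 * (2 * N + 1) + 1) powr E"
      using morrey_unit_sum_powr[OF y] by (simp only: E_def d_def)
    \<comment> \<open>The enlarged cube has side \<open>4 * N + 3\<close>, at most three times
      \<open>L\<close>.\<close>
    also have "\<dots> \<le> (3 * L) powr E"
      using E by (intro powr_mono2) (auto simp: L_def)
    also have "\<dots> = 3 powr E * L powr E" using L by (simp add: powr_mult)
    finally show ?thesis using C by (simp add: L_def distrib_right mult.assoc)
  qed
  moreover have "0 < C1 + C2 * C3 * 3 powr E" using C by (simp add: add_pos_pos)
  ultimately show ?thesis using that unfolding E_def d_def by blast
qed

section \<open>Normalisation and passage to infinite sums\<close>

text \<open>Any positive upper bound \<open>A\<close> serves as normaliser, so a norm equal to zero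
  needs no separate treatment.\<close>

lemma morrey_unit_scale:
  fixes x :: "int ^ 'd \<Rightarrow> real"
  assumes A: "0 < A" "\<And>m N. morrey_avg p q x m N \<le> A" and p: "0 < p"
  shows "morrey_unit p q (\<lambda>i. \<bar>x i\<bar> / A)"
  unfolding morrey_unit_def
proof (intro conjI allI)
  fix m :: "int ^ 'd" and N
  define n where "n = real (card (cube m N))"
  define S where "S = (\<Sum>k\<in>cube m N. \<bar>x k\<bar> powr p)"
  have n: "n = real (2 * N + 1) powr real CARD('d)"
    by (simp add: n_def card_cube powr_realpow)
  then have n0: "0 < n" by simp
  have S0: "0 \<le> S" by (simp add: S_def sum_nonneg)
  have "n powr (1 / q - 1 / p) * S powr (1 / p) \<le> A"
    using A(2)[of m N] by (simp add: morrey_avg_def n_def S_def)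
  then have "(n powr (1 / q - 1 / p) * S powr (1 / p)) powr p \<le> A powr p"
    using p by (intro powr_mono2) auto
  moreover have "(1 / q - 1 / p) * p = - (1 - p / q)" using p by (simp add: left_diff_distrib)
  ultimately have "n powr (- (1 - p / q)) * S \<le> A powr p"
    using p S0 by (simp add: powr_mult powr_powr)
  then have "S \<le> A powr p * n powr (1 - p / q)"
    using n0 by (simp only: powr_minus) (simp add: field_simps)
  then have "S / A powr p \<le> n powr (1 - p / q)"
    using A(1) by (simp add: field_simps)
  then show "(\<Sum>k\<in>cube m N. (\<bar>x k\<bar> / A) powr p) \<le> real (2 * N + 1) powr (real CARD('d) * (1 - p / q))"
    using A(1) unfolding n by (simp add: S_def powr_divide sum_divide_distrib powr_powr)
qed (use A in auto)

text \<open>The case \<open>N = 0\<close> of the assumption bounds the partial sums at a single point, whence summability.\<close>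
lemma riesz_infsum_powr_le:
  fixes y :: "int ^ 'd \<Rightarrow> real"
  assumes y: "\<And>i. 0 \<le> y i" and s: "0 < s"
    and C: "\<And>T m N. finite T \<Longrightarrow>
       (\<Sum>k\<in>cube m N. (\<Sum>i\<in>T. riesz_term \<alpha> y k i) powr s) \<le> C * real (2 * N + 1) powr c"
  shows "riesz_term \<alpha> y k summable_on UNIV"
    and "(\<Sum>k\<in>cube m N. (\<Sum>\<^sub>\<infinity>i. riesz_term \<alpha> y k i) powr s) \<le> C * real (2 * N + 1) powr c"
proof -
  have rt0: "0 \<le> riesz_term \<alpha> y k i" for k i by (simp add: riesz_term_eq y)
  have summable: "riesz_term \<alpha> y k summable_on UNIV" for k
  proof (rule nonneg_bdd_above_summable_on)
    have "sum (riesz_term \<alpha> y k) F \<le> C powr (1 / s)" if "finite F" for F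
    proof -
      have "k \<in> cube k 0" by (simp add: cube_def inf_norm_zero)
      then have "sum (riesz_term \<alpha> y k) F powr s \<le> (\<Sum>k\<in>cube k 0. sum (riesz_term \<alpha> y k) F powr s)"
        by (intro member_le_sum[where f="\<lambda>k. sum (riesz_term \<alpha> y k) F powr s"]) (auto simp: finite_cube)
      also have "\<dots> \<le> C" using C[OF that, of k 0] by simp
      finally have "(sum (riesz_term \<alpha> y k) F powr s) powr (1 / s) \<le> C powr (1 / s)"
        using s by (intro powr_mono2) auto
      then show ?thesis using s by (simp add: powr_powr sum_nonneg rt0)
    qed
    then show "bdd_above (sum (riesz_term \<alpha> y k) ` {F. F \<subseteq> UNIV \<and> finite F})"
      by (intro bdd_aboveI[of _ "C powr (1 / s)"]) auto
  qed (rule rt0)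
  then show "riesz_term \<alpha> y k summable_on UNIV" .
  \<comment> \<open>The outer sum is finite and \<open>0 < s\<close>, so the limit along finite sets
    \<open>T\<close> passes through both the power and the outer sum; the bound, being uniform in
    \<open>T\<close>, survives.\<close>
  have "((\<lambda>T. \<Sum>k\<in>cube m N. (\<Sum>i\<in>T. riesz_term \<alpha> y k i) powr s) \<longlongrightarrow>
      (\<Sum>k\<in>cube m N. (\<Sum>\<^sub>\<infinity>i. riesz_term \<alpha> y k i) powr s)) (finite_subsets_at_top UNIV)"
    using s by (intro tendsto_sum tendsto_powr2 tendsto_const infsum_tendsto[OF summable])
      (auto simp: sum_nonneg rt0)
  then show "(\<Sum>k\<in>cube m N. (\<Sum>\<^sub>\<infinity>i. riesz_term \<alpha> y k i) powr s) \<le> C * real (2 * N + 1) powr c"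
    by (rule tendsto_upperbound) (rule eventually_finite_subsets_at_top_weakI, rule C, simp_all)
qed

text \<open>Undoes the normalisation: the terms of \<open>x\<close> are in absolute value
  \<open>A\<close> times those of \<open>y = \<bar>x\<bar> / A\<close>, which yields absolute
  summability and bounds the potential of \<open>x\<close> by \<open>A\<close> times that of
  \<open>y\<close>.\<close>

lemma riesz_morrey_avg_le:
  fixes \<alpha> p q s t :: real
  assumes \<alpha>: "0 < \<alpha>" "\<alpha> < real CARD('d)" and p: "1 < p" "p < q" and q: "q < real CARD('d) / \<alpha>"
    and s: "s = real CARD('d) * p / (real CARD('d) - \<alpha> * q)" and t: "t = q * s / p"
  obtains C where "0 < C"
    "\<And>(x :: int ^ 'd \<Rightarrow> real) A k. 0 < A \<Longrightarrow> (\<And>m N. morrey_avg p q x m N \<le> A) \<Longrightarrow>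
       riesz_term \<alpha> x k summable_on UNIV - {k}"
    "\<And>(x :: int ^ 'd \<Rightarrow> real) A m N. 0 < A \<Longrightarrow> (\<And>m N. morrey_avg p q x m N \<le> A) \<Longrightarrow>
       morrey_avg s t (riesz_potential \<alpha> x) m N \<le> C * A"
proof -
  obtain C where C: "0 < C"
    "\<And>(y :: int ^ 'd \<Rightarrow> real) T m N. morrey_unit p q y \<Longrightarrow> finite T \<Longrightarrow>
       (\<Sum>k\<in>cube m N. (\<Sum>i\<in>T. riesz_term \<alpha> y k i) powr s)
         \<le> C * real (2 * N + 1) powr (real CARD('d) * (1 - p / q))"
    using riesz_finite_sum_powr_le[OF \<alpha> p q s] by blast
  have "\<alpha> * q < real CARD('d)" using q \<alpha> by (simp add: field_simps)
  then have s0: "0 < s" using p by (simp add: s)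
  \<comment> \<open>Since \<open>1 / t = (p / q) / s\<close>, the cardinality factor of the target
    norm cancels the growth of the sum exactly.\<close>
  have st: "1 / t - 1 / s = - ((1 - p / q) / s)"
    using p s0 by (simp add: t field_simps)
  have *: "riesz_term \<alpha> x k summable_on UNIV - {k}"
    "morrey_avg s t (riesz_potential \<alpha> x) m N \<le> C powr (1 / s) * A"
    if A: "0 < A" "\<And>m N. morrey_avg p q x m N \<le> A" for x :: "int ^ 'd \<Rightarrow> real" and A k m N
  proof -
    define y where "y i = \<bar>x i\<bar> / A" for i
    have y: "morrey_unit p q y" unfolding y_def using A p by (intro morrey_unit_scale) auto
    note sy = riesz_infsum_powr_le[OF morrey_unit_nonneg[OF y] s0 C(2)[OF y]]
    have abs: "\<bar>riesz_term \<alpha> x k i\<bar> = A * riesz_term \<alpha> y k i" for k i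
      using A by (simp add: riesz_term_eq y_def abs_mult)
    have abs_summable: "(\<lambda>i. norm (riesz_term \<alpha> x k i)) summable_on UNIV" for k
      using sy(1)[of k] by (simp add: abs summable_on_cmult_right)
    have summable: "riesz_term \<alpha> x k summable_on UNIV - {k} \<longleftrightarrow> riesz_term \<alpha> x k summable_on UNIV" for k
      by (rule summable_on_cong_neutral) (auto simp: riesz_term_self)
    show "riesz_term \<alpha> x k summable_on UNIV - {k}"
      unfolding summable using abs_summable by (rule abs_summable_summable)
    have pot: "\<bar>riesz_potential \<alpha> x k\<bar> \<le> A * (\<Sum>\<^sub>\<infinity>i. riesz_term \<alpha> y k i)" for k
    proof -
      have "riesz_potential \<alpha> x k = (\<Sum>\<^sub>\<infinity>i. riesz_term \<alpha> x k i)"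
        unfolding riesz_potential_def by (rule infsum_cong_neutral) (auto simp: riesz_term_self)
      then show ?thesis
        using norm_infsum_bound[OF abs_summable[of k]] by (simp add: abs infsum_cmult_right')
    qed
    define n where "n = real (2 * N + 1) powr real CARD('d)"
    have n0: "0 < n" by (simp add: n_def)
    have n: "real (card (cube m N)) = n" by (simp add: n_def card_cube powr_realpow)
    have "(\<Sum>k\<in>cube m N. \<bar>riesz_potential \<alpha> x k\<bar> powr s)
        \<le> (\<Sum>k\<in>cube m N. (A * (\<Sum>\<^sub>\<infinity>i. riesz_term \<alpha> y k i)) powr s)"
      using s0 pot by (intro sum_mono powr_mono2) auto
    also have "\<dots> = A powr s * (\<Sum>k\<in>cube m N. (\<Sum>\<^sub>\<infinity>i. riesz_term \<alpha> y k i) powr s)"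
      using A(1) by (simp add: powr_mult sum_distrib_left infsum_nonneg riesz_term_eq morrey_unit_nonneg[OF y])
    also have "\<dots> \<le> A powr s * (C * n powr (1 - p / q))"
      using sy(2)[of m N] by (intro mult_left_mono) (auto simp: n_def powr_powr)
    finally have "(\<Sum>k\<in>cube m N. \<bar>riesz_potential \<alpha> x k\<bar> powr s) powr (1 / s)
        \<le> (A powr s * (C * n powr (1 - p / q))) powr (1 / s)"
      using s0 by (intro powr_mono2) (auto intro: sum_nonneg)
    also have "\<dots> = C powr (1 / s) * A * n powr ((1 - p / q) / s)"
      using A(1) C(1) s0 by (simp add: powr_mult powr_powr)
    finally have "n powr (1 / t - 1 / s) * (\<Sum>k\<in>cube m N. \<bar>riesz_potential \<alpha> x k\<bar> powr s) powr (1 / s)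
        \<le> n powr (1 / t - 1 / s) * (C powr (1 / s) * A * n powr ((1 - p / q) / s))"
      by (rule mult_left_mono) simp
    also have "\<dots> = C powr (1 / s) * A * (n powr (1 / t - 1 / s) * n powr ((1 - p / q) / s))"
      by (simp only: mult_ac)
    also have "\<dots> = C powr (1 / s) * A * (n powr (- ((1 - p / q) / s)) * n powr ((1 - p / q) / s))"
      by (simp only: st)
    also have "\<dots> = C powr (1 / s) * A"
      using n0 by (simp flip: powr_add)
    finally show "morrey_avg s t (riesz_potential \<alpha> x) m N \<le> C powr (1 / s) * A"
      unfolding morrey_avg_def n .
  qed
  show ?thesis by (rule that[of "C powr (1 / s)"]) (use C(1) * in auto)
qed

section \<open>Boundedness of the Riesz potential between Morrey spaces\<close>

theorem theorem3p3:
  fixes \<alpha> p q s t :: real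
  assumes "0 < \<alpha>" and "\<alpha> < real CARD('d::finite)"
    and "1 < p" and "p < q" and "q < real CARD('d) / \<alpha>"
    and "s = real CARD('d) * p / (real CARD('d) - \<alpha> * q)"
    and "t = q * s / p"
  shows "(\<forall>x \<in> (morrey_space p q :: (int ^ 'd \<Rightarrow> real) set).
            (\<forall>k. (riesz_term \<alpha> x k) summable_on (UNIV - {k})) \<and>
            riesz_potential \<alpha> x \<in> morrey_space s t) \<and>
         (\<exists>C>0. \<forall>x \<in> (morrey_space p q :: (int ^ 'd \<Rightarrow> real) set).
            morrey_norm s t (riesz_potential \<alpha> x) \<le> C * morrey_norm p q x)"
proof -
  obtain C where C: "0 < C"
    "\<And>(x :: int ^ 'd \<Rightarrow> real) A k. 0 < A \<Longrightarrow> (\<And>m N. morrey_avg p q x m N \<le> A) \<Longrightarrow>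
       riesz_term \<alpha> x k summable_on UNIV - {k}"
    "\<And>(x :: int ^ 'd \<Rightarrow> real) A m N. 0 < A \<Longrightarrow> (\<And>m N. morrey_avg p q x m N \<le> A) \<Longrightarrow>
       morrey_avg s t (riesz_potential \<alpha> x) m N \<le> C * A"
    using riesz_morrey_avg_le[OF assms] by blast
  have avg: "morrey_avg p q x m N \<le> morrey_norm p q x"
    if "x \<in> morrey_space p q" for x :: "int ^ 'd \<Rightarrow> real" and m N
    using that unfolding morrey_norm_def morrey_space_def by (intro cSup_upper) auto
  have norm0: "0 \<le> morrey_norm p q x" if "x \<in> morrey_space p q" for x :: "int ^ 'd \<Rightarrow> real"
  proof -
    have "0 \<le> morrey_avg p q x 0 0" by (simp add: morrey_avg_def)
    then show ?thesis using avg[OF that] by (rule order_trans)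
  qed
  show ?thesis
  proof (intro conjI ballI allI exI[of _ C])
    fix x :: "int ^ 'd \<Rightarrow> real" assume x: "x \<in> morrey_space p q"
    have avg': "morrey_avg p q x m N \<le> A" if "morrey_norm p q x < A" for m N A
      using avg[OF x, of m N] that by simp
    have *: "morrey_avg s t (riesz_potential \<alpha> x) m N \<le> C * A" if "morrey_norm p q x < A" for m N A
      using norm0[OF x] that by (intro C(3) avg'[OF that]) auto
    show "riesz_term \<alpha> x k summable_on UNIV - {k}" for k
      using norm0[OF x] by (intro C(2)[of "morrey_norm p q x + 1"] avg') auto
    show "riesz_potential \<alpha> x \<in> morrey_space s t"
      unfolding morrey_space_def mem_Collect_eq
      by (rule bdd_aboveI[of _ "C * (morrey_norm p q x + 1)"]) (use * in force)
    \<comment> \<open>The bound is applied with \<open>A\<close> strictly above the norm, since a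
      zero norm would violate \<open>0 < A\<close>. Letting \<open>A\<close> decrease to the norm
      keeps the constant \<open>C\<close>; the division isolates \<open>A\<close> for
      \<open>dense_ge\<close>.\<close>
    have "morrey_norm s t (riesz_potential \<alpha> x) / C \<le> morrey_norm p q x"
    proof (rule dense_ge)
      fix A assume A: "morrey_norm p q x < A"
      have "morrey_norm s t (riesz_potential \<alpha> x) \<le> C * A"
        unfolding morrey_norm_def by (rule cSup_least) (use *[OF A] in auto)
      then show "morrey_norm s t (riesz_potential \<alpha> x) / C \<le> A"
        using C(1) by (simp add: field_simps)
    qed
    then show "morrey_norm s t (riesz_potential \<alpha> x) \<le> C * morrey_norm p q x"
      using C(1) by (simp add: field_simps)
  qed (rule C(1))
qed

end
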